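(* Let $n$ be a positive integer, $0<\alpha_1,\alpha_2<1$, and let $\underline{W}=(W_1,W_2)$ be a random vector following the negative $\mathcal{R}(p,q)$-trinomial probability distribution of the first kind with parameters $n$, $\underline{\alpha}=(\alpha_1,\alpha_2)$, $p$ and $q$, i.e. with mass function $$P(W_1=w_1,W_2=w_2)=\begin{bmatrix} n+w_1+w_2-1\\ w_1,w_2\end{bmatrix}_{\mathcal{R}(p,q)}\frac{\alpha_1^{w_1}\alpha_2^{w_2}\,\phi_1^{\binom{n-w_1}{2}+\binom{n-w_2}{2}}\,\phi_2^{\binom{w_1}{2}+\binom{w_2}{2}}}{(1\oplus\alpha_1)^{n+w_1+w_2}_{\mathcal{R}(p,q)}\,(1\oplus\alpha_2)^{n+w_2}_{\mathcal{R}(p,q)}},\qquad w_1,w_2\in\mathbb{N}\cup\{0\}.$$ Then for all $m_1,m_2\in\mathbb{N}\cup\{0\}$ its $\mathcal{R}(p^{-1},q^{-1})$-factorial moments are given as follows. (1) $$E\big([W_2]_{m_2,\mathcal{R}(p^{-1},q^{-1})}\big)=\alpha_2^{m_2}\,[n+m_2-1]_{m_2,\mathcal{R}(p,q)}.$$ (2) For $w_2\in\mathbb{N}\cup\{0\}$, $$E\big([W_1]_{m_1,\mathcal{R}(p^{-1},q^{-1})}\mid W_2=w_2\big)=\alpha_1^{m_1}\,[n+w_2+m_1-1]_{m_1,\mathcal{R}(p,q)}.$$ (3) $$E\left(\frac{[W_1]_{m_1,\mathcal{R}(p^{-1},q^{-1})}}{\big(\phi_1^{n+W_2}\oplus\alpha_2\,\phi_2^{n+W_2}\big)^{m_1}_{\mathcal{R}(p,q)}}\right)=\alpha_1^{m_1}\,[n+m_1-1]_{m_1,\mathcal{R}(p,q)}.$$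 (4) $$E\left(\frac{[W_1]_{m_1,\mathcal{R}(p^{-1},q^{-1})}\,[W_2]_{m_2,\mathcal{R}(p^{-1},q^{-1})}}{\big(\phi_1^{n+W_2}\oplus\alpha_2\,\phi_2^{n+W_2}\big)^{m_1}_{\mathcal{R}(p,q)}}\right)=\alpha_1^{m_1}\alpha_2^{m_2}\,[n+m_1+m_2-1]_{m_1+m_2,\mathcal{R}(p,q)}.$$
   Context: Let $0<q<p<1$ be real numbers and let $\mathcal{R}(u,v)=\sum_{s,t=-l}^{\infty}r_{st}u^sv^t$ ($r_{st}\in\mathbb{C}$, $l\in\mathbb{N}\cup\{0\}$) be a meromorphic function on $\mathbb{C}\times\mathbb{C}$ with $\mathcal{R}(p^n,q^n)>0$ for all $n\in\mathbb{N}$ and $\mathcal{R}(1,1)=0$. The $\mathcal{R}(p,q)$-deformed numbers are $[n]_{\mathcal{R}(p,q)}=\mathcal{R}(p^n,q^n)$, and it is assumed that they can be written as $[n]_{\mathcal{R}(p,q)}=\frac{\phi_1^n-\phi_2^n}{\phi_1-\phi_2}$, where $\phi_1\ne\phi_2$ are functions of the deformation parameters $p,q$. Factorials: $[0]!_{\mathcal{R}(p,q)}=1$ and $[n]!_{\mathcal{R}(p,q)}=\prod_{i=1}^{n}[i]_{\mathcal{R}(p,q)}$. Factorial of order $r$: $[u]_{r,\mathcal{R}(p,q)}=\prod_{i=1}^{r}[u-i+1]_{\mathcal{R}(p,q)}$, equal to $1$ for $r=0$. The $\mathcal{R}(p^{-1},q^{-1})$-quantities satisfy $[x]_{\mathcal{R}(p^{-1},q^{-1})}=(\phi_1\phi_2)^{1-x}[x]_{\mathcal{R}(p,q)}$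 and hence $[x]_{r,\mathcal{R}(p^{-1},q^{-1})}=(\phi_1\phi_2)^{-xr+\binom{r+1}{2}}[x]_{r,\mathcal{R}(p,q)}$. Trinomial coefficient: $\begin{bmatrix} N\\ a,b\end{bmatrix}_{\mathcal{R}(p,q)}=\frac{[N]!_{\mathcal{R}(p,q)}}{[a]!_{\mathcal{R}(p,q)}[b]!_{\mathcal{R}(p,q)}[N-a-b]!_{\mathcal{R}(p,q)}}$. Shifted factorial: $(u\oplus v)^n_{\mathcal{R}(p,q)}=\prod_{i=1}^{n}(u\phi_1^{i-1}+v\phi_2^{i-1})$, with $(u\oplus v)^0_{\mathcal{R}(p,q)}=1$. For integers $k$ (possibly negative), $\binom{k}{2}=k(k-1)/2$. $E$ denotes expectation.
   Formalization: The displayed mass function is additionally assumed to be a probability mass function for all n≥1 and all α₁,α₂ in (0,1), which forces φ₁=1; with only the given n and α the claim fails, e.g. φ₁=0.9, φ₂=1.3, n=1, α₁=0.3 and a suitable α₂. *)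

theory Defs
  imports "HOL-Probability.Probability"
begin

text \<open>
  For fixed deformation parameters \<open>p\<close> and \<open>q\<close>, the functions \<open>\<phi>\<^sub>1\<close> and \<open>\<phi>\<^sub>2\<close> of these
  parameters are represented by their values. These are real: since all deformed numbers are real,
  \<open>\<phi>\<^sub>1 + \<phi>\<^sub>2 = [2]\<close> and \<open>\<phi>\<^sub>1 * \<phi>\<^sub>2 = [2]\<^sup>2 - [3]\<close> are real, and conjugate non-real values would
  contradict the positivity of all \<open>[n]\<close>. They are nonzero because \<open>\<phi>\<^sub>1 * \<phi>\<^sub>2\<close> is raised to
  negative powers. The series represents \<open>R\<close> off the coordinate axes, where \<open>R\<close> may have poles.
\<close>

locale Rpq_deformation =
  fixes p q :: real
    and R :: "complex \<Rightarrow> complex \<Rightarrow> complex"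
    and r :: "int \<Rightarrow> int \<Rightarrow> complex"
    and l :: nat
    and \<phi>\<^sub>1 \<phi>\<^sub>2 :: real
  assumes q_pos: "0 < q" and q_less_p: "q < p" and p_less_1: "p < 1"
    and R_series: "\<And>u v. u \<noteq> 0 \<Longrightarrow> v \<noteq> 0 \<Longrightarrow>
          ((\<lambda>(s, t). r s t * u powi s * v powi t) has_sum R u v) ({- int l..} \<times> {- int l..})"
    and R_pos: "\<And>n::nat. 1 \<le> n \<Longrightarrow>
          R (of_real p ^ n) (of_real q ^ n) \<in> \<real> \<and> 0 < Re (R (of_real p ^ n) (of_real q ^ n))"
    and R_1_1: "R 1 1 = 0"
    and phi_distinct: "\<phi>\<^sub>1 \<noteq> \<phi>\<^sub>2"
    and phi_nonzero: "\<phi>\<^sub>1 \<noteq> 0" "\<phi>\<^sub>2 \<noteq> 0"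
    and R_phi: "\<And>n::nat. R (of_real p ^ n) (of_real q ^ n)
          = of_real ((\<phi>\<^sub>1 ^ n - \<phi>\<^sub>2 ^ n) / (\<phi>\<^sub>1 - \<phi>\<^sub>2))"

definition Rnum :: "(complex \<Rightarrow> complex \<Rightarrow> complex) \<Rightarrow> real \<Rightarrow> real \<Rightarrow> int \<Rightarrow> real" where
  "Rnum R p q x = Re (R (of_real p powi x) (of_real q powi x))"

text \<open>The number \<open>[x]\<close> for the inverted parameters \<open>1/p\<close>, \<open>1/q\<close>; for the inverted parameters
  the values \<open>\<phi>\<^sub>i\<close> become \<open>1/\<phi>\<^sub>i\<close>, which gives the factor below.\<close>

definition Rnum_inv ::
    "(complex \<Rightarrow> complex \<Rightarrow> complex) \<Rightarrow> real \<Rightarrow> real \<Rightarrow> real \<Rightarrow> real \<Rightarrow> int \<Rightarrow> real" where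
  "Rnum_inv R p q \<phi>\<^sub>1 \<phi>\<^sub>2 x = (\<phi>\<^sub>1 * \<phi>\<^sub>2) powi (1 - x) * Rnum R p q x"

text \<open>In the following definitions \<open>N\<close> is the function \<open>x \<mapsto> [x]\<close>. If \<open>0 \<le> u < k\<close>, then
  \<open>falling N u k\<close> contains the factor \<open>[0] = 0\<close>, so the values of \<open>N\<close> at negative arguments
  do not matter.\<close>

definition factorial :: "(int \<Rightarrow> real) \<Rightarrow> nat \<Rightarrow> real" where
  "factorial N n = (\<Prod>i=1..n. N (int i))"

definition falling :: "(int \<Rightarrow> real) \<Rightarrow> int \<Rightarrow> nat \<Rightarrow> real" where
  "falling N u k = (\<Prod>i=1..k. N (u - int i + 1))"

definition trinomial :: "(int \<Rightarrow> real) \<Rightarrow> nat \<Rightarrow> nat \<Rightarrow> nat \<Rightarrow> real" where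
  "trinomial N m a b = factorial N m / (factorial N a * factorial N b * factorial N (m - a - b))"

definition oplus_power :: "real \<Rightarrow> real \<Rightarrow> real \<Rightarrow> real \<Rightarrow> nat \<Rightarrow> real" where
  "oplus_power \<phi>\<^sub>1 \<phi>\<^sub>2 u v n = (\<Prod>i=1..n. u * \<phi>\<^sub>1 ^ (i - 1) + v * \<phi>\<^sub>2 ^ (i - 1))"

definition choose_two :: "int \<Rightarrow> int" where
  "choose_two k = k * (k - 1) div 2"

definition neg_trinomial_mass ::
    "(int \<Rightarrow> real) \<Rightarrow> real \<Rightarrow> real \<Rightarrow> nat \<Rightarrow> real \<Rightarrow> real \<Rightarrow> nat \<Rightarrow> nat \<Rightarrow> real" where
  "neg_trinomial_mass N \<phi>\<^sub>1 \<phi>\<^sub>2 n \<alpha>\<^sub>1 \<alpha>\<^sub>2 w\<^sub>1 w\<^sub>2 =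
     trinomial N (n + w\<^sub>1 + w\<^sub>2 - 1) w\<^sub>1 w\<^sub>2 *
     (\<alpha>\<^sub>1 ^ w\<^sub>1 * \<alpha>\<^sub>2 ^ w\<^sub>2
       * \<phi>\<^sub>1 powi (choose_two (int n - int w\<^sub>1) + choose_two (int n - int w\<^sub>2))
       * \<phi>\<^sub>2 powi (choose_two (int w\<^sub>1) + choose_two (int w\<^sub>2)))
     / (oplus_power \<phi>\<^sub>1 \<phi>\<^sub>2 1 \<alpha>\<^sub>1 (n + w\<^sub>1 + w\<^sub>2) * oplus_power \<phi>\<^sub>1 \<phi>\<^sub>2 1 \<alpha>\<^sub>2 (n + w\<^sub>2))"

text \<open>
  The mass functions form a family of probability distributions: they are nonnegative and sum to
  \<open>1\<close> for all \<open>n \<ge> 1\<close> and \<open>0 < \<alpha>\<^sub>1, \<alpha>\<^sub>2 < 1\<close>. The name ``negative trinomial probability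
  distribution with parameters \<open>n\<close>, \<open>\<alpha>\<close>'' presupposes this, but it is a genuine condition on
  \<open>\<phi>\<^sub>1\<close> and \<open>\<phi>\<^sub>2\<close>, which forces \<open>\<phi>\<^sub>1 = 1\<close>. It is required of the whole family, since for
  isolated parameters the masses can sum to \<open>1\<close> by coincidence, and then the moment formulas
  can fail: for instance with \<open>\<phi>\<^sub>1 = p = 9/10\<close>, \<open>\<phi>\<^sub>2 = 1/q = 13/10\<close>, \<open>n = 1\<close>, \<open>\<alpha>\<^sub>1 = 3/10\<close>
  and a value \<open>\<alpha>\<^sub>2\<close> between \<open>0.937\<close> and \<open>0.938\<close>.
\<close>

definition neg_trinomial_family :: "(int \<Rightarrow> real) \<Rightarrow> real \<Rightarrow> real \<Rightarrow> bool" where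
  "neg_trinomial_family N \<phi>\<^sub>1 \<phi>\<^sub>2 \<longleftrightarrow>
     (\<forall>n\<ge>1. \<forall>\<alpha>\<^sub>1\<in>{0<..<1}. \<forall>\<alpha>\<^sub>2\<in>{0<..<1}.
        (\<forall>w\<^sub>1 w\<^sub>2. 0 \<le> neg_trinomial_mass N \<phi>\<^sub>1 \<phi>\<^sub>2 n \<alpha>\<^sub>1 \<alpha>\<^sub>2 w\<^sub>1 w\<^sub>2) \<and>
        ((\<lambda>(w\<^sub>1, w\<^sub>2). neg_trinomial_mass N \<phi>\<^sub>1 \<phi>\<^sub>2 n \<alpha>\<^sub>1 \<alpha>\<^sub>2 w\<^sub>1 w\<^sub>2) has_sum 1) UNIV)"

end

theory Submission
  imports Defs
begin

text \<open>
  The requirement that the masses are nonnegative and sum to \<open>1\<close> for all parameters forces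
  \<open>\<phi>\<^sub>1 = 1\<close> and \<open>\<phi>\<^sub>2 > 0\<close>. It suffices to look at \<open>n = 1\<close>. With \<open>a = \<phi>\<^sub>1\<close> and
  \<open>b = \<phi>\<^sub>2\<close>, the masses at \<open>(0, 0)\<close>, \<open>(1, 0)\<close> and \<open>(2, 0)\<close> give \<open>b > 0\<close> and
  \<open>a \<ge> 1\<close> (\<open>family_signs\<close>, \<open>family_imp_a_ge_1\<close>). If \<open>a > 1\<close> and \<open>b > 1\<close>, the
  masses do not even tend to \<open>0\<close> (\<open>family_imp_b_le_1\<close>). If \<open>a > 1 \<ge> b\<close>, a geometric
  majorant shows that the total mass is below \<open>1\<close> for small \<open>\<alpha>\<close>
  (\<open>family_imp_not_b_le_1\<close>).

  Let now \<open>\<phi>\<^sub>1 = 1\<close> and \<open>Q = \<phi>\<^sub>2\<close>. Let \<open>negbin \<alpha> j i\<close> be the probability of exactly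
  \<open>i\<close> successes before failure number \<open>j + 1\<close>, in independent trials whose odds of success are
  \<open>\<alpha>\<close>, \<open>\<alpha> * Q\<close>, \<open>\<alpha> * Q\<^sup>2\<close> and so on. The trinomial mass for \<open>n + 1\<close> factors as
  \<open>negbin \<alpha>\<^sub>1 (n + w\<^sub>2) w\<^sub>1 * negbin \<alpha>\<^sub>2 n w\<^sub>2\<close>. Partial sums of \<open>negbin\<close> never exceed
  \<open>1\<close> (\<open>sum_negbin_le_1\<close>), hence the normalization of the trinomial family makes
  each \<open>negbin \<alpha> n\<close> sum to exactly \<open>1\<close> (\<open>negbin_sums_1\<close>); this covers all values of
  \<open>Q\<close> at once.

  So \<open>W\<^sub>2\<close> has the distribution \<open>negbin \<alpha>\<^sub>2 n\<close>, and \<open>W\<^sub>1\<close> has the distribution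
  \<open>negbin \<alpha>\<^sub>1 (n + w\<^sub>2)\<close> given \<open>W\<^sub>2 = w\<^sub>2\<close>. A mass of \<open>negbin \<alpha> n\<close>, weighted by
  the factorial of order \<open>m\<close> for the inverted parameters, is
  \<open>\<alpha> ^ m * [n + m]\<^sub>m\<close> times a mass of \<open>negbin \<alpha> (n + m)\<close>
  (\<open>falling_inv_number_negbin\<close>), and normalization for \<open>n + m\<close> gives the moment. For the
  mixed moment, the divisor turns the conditional moment of \<open>W\<^sub>1\<close> into another shift of the
  number of failures (\<open>falling_negbin_div_oplus_power\<close>). The moments of \<open>W\<^sub>2\<close> alone and of
  \<open>W\<^sub>1\<close> with the divisor are the mixed moments for \<open>m\<^sub>1 = 0\<close> and \<open>m\<^sub>2 = 0\<close>.
\<close>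

section \<open>Deformed numbers and binomial coefficients\<close>

lemma choose_two_of_nat: "choose_two (int w) = int (w choose 2)"
  by (cases w) (simp_all add: choose_two_def choose_two zdiv_int of_nat_diff algebra_simps)

lemma choose_two_one_minus: "choose_two (1 - int w) = int (w choose 2)"
proof -
  have "choose_two (1 - int w) = choose_two (int w)"
    by (simp add: choose_two_def algebra_simps)
  then show ?thesis by (simp add: choose_two_of_nat)
qed

lemma Suc_choose_two: "Suc w choose 2 = (w choose 2) + w"
  by (simp add: numeral_2_eq_2)

lemma choose_two_small [simp]: "0 choose 2 = (0::nat)" "Suc 0 choose 2 = 0"
  by (simp_all add: numeral_2_eq_2)

lemma factorial_0 [simp]: "factorial N 0 = 1"
  by (simp add: factorial_def)

lemma factorial_Suc: "factorial N (Suc k) = N (int (Suc k)) * factorial N k"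
  by (simp add: factorial_def)

lemma falling_0 [simp]: "falling N u 0 = 1"
  by (simp add: falling_def)

lemma falling_Suc: "falling N u (Suc k) = N u * falling N (u - 1) k"
proof -
  have "falling N u (Suc k) = (\<Prod>i\<in>{0..k}. N (u - int (Suc i) + 1))"
    using prod.atLeast_Suc_atMost_Suc_shift [of "\<lambda>i. N (u - int i + 1)" 0 k]
    by (simp add: falling_def)
  also have "\<dots> = N u * (\<Prod>i\<in>{1..k}. N (u - int (Suc i) + 1))"
    by (subst prod.atLeast_Suc_atMost) auto
  finally show ?thesis by (simp add: falling_def algebra_simps)
qed

lemma falling_eq_0:
  assumes "N 0 = 0" "w < m"
  shows "falling N (int w) m = 0"
proof -
  have "Suc w \<in> {1..m}" "N (int w - int (Suc w) + 1) = 0" using assms by auto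
  then show ?thesis unfolding falling_def by (meson finite_atLeastAtMost prod_zero)
qed

lemma oplus_power_0 [simp]: "oplus_power a b u v 0 = 1"
  by (simp add: oplus_power_def)

lemma oplus_power_Suc: "oplus_power a b u v (Suc k) = oplus_power a b u v k * (u * a ^ k + v * b ^ k)"
  by (simp add: oplus_power_def)

lemma oplus_power_add:
  "oplus_power a b u v (j + k)
    = oplus_power a b u v j * oplus_power a b (u * a ^ j) (v * b ^ j) k"
  by (induction k) (simp_all add: oplus_power_Suc power_add mult.assoc)

locale deformed_numbers =
  fixes N :: "int \<Rightarrow> real" and a b :: real
  assumes a_neq_b: "a \<noteq> b"
    and number: "\<And>k::nat. N (int k) = (a ^ k - b ^ k) / (a - b)"
    and number_pos: "\<And>k::nat. 1 \<le> k \<Longrightarrow> 0 < N (int k)"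
begin

lemma number_0 [simp]: "N 0 = 0"
  using number [of 0] by simp

lemma number_Suc_pos: "0 < N (int (Suc k))"
  by (rule number_pos) simp

lemma factorial_pos: "0 < factorial N k"
  by (induction k) (auto simp: factorial_Suc simp del: of_nat_Suc intro!: mult_pos_pos number_Suc_pos)

lemma number_add: "N (int (j + k)) = a ^ j * N (int k) + b ^ k * N (int j)"
proof -
  have "a ^ (j + k) - b ^ (j + k) = a ^ j * (a ^ k - b ^ k) + b ^ k * (a ^ j - b ^ j)"
    by (simp add: power_add algebra_simps)
  then show ?thesis by (simp only: number add_divide_distrib times_divide_eq_right)
qed

text \<open>The deformed binomial coefficient is indexed by its two lower entries, so that
  the recursion below is free of truncated subtraction.\<close>

definition binom :: "nat \<Rightarrow> nat \<Rightarrow> real" where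
  "binom i j = factorial N (i + j) / (factorial N i * factorial N j)"

lemma binom_pos: "0 < binom i j"
  by (simp add: binom_def factorial_pos)

lemma binom_0 [simp]: "binom 0 j = 1" "binom i 0 = 1"
  using factorial_pos [of i] factorial_pos [of j] by (simp_all add: binom_def)

lemma binom_Suc_Suc: "binom (Suc i) (Suc j) = a ^ Suc i * binom (Suc i) j + b ^ Suc j * binom i (Suc j)"
proof -
  have "N (int (Suc i + Suc j)) = a ^ Suc i * N (int (Suc j)) + b ^ Suc j * N (int (Suc i))"
    by (rule number_add)
  then have "factorial N (Suc i + Suc j)
      = (a ^ Suc i * N (int (Suc j)) + b ^ Suc j * N (int (Suc i))) * factorial N (Suc (i + j))"
    by (simp only: factorial_Suc add_Suc add_Suc_right)
  moreover have "binom (Suc i) j = N (int (Suc j)) * factorial N (Suc (i + j)) / (factorial N (Suc i) * factorial N (Suc j))"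
    using number_Suc_pos [of j] factorial_pos [of j]
    by (simp add: binom_def factorial_Suc [of N j] del: of_nat_Suc)
  moreover have "binom i (Suc j) = N (int (Suc i)) * factorial N (Suc (i + j)) / (factorial N (Suc i) * factorial N (Suc j))"
    using number_Suc_pos [of i] factorial_pos [of i]
    by (simp add: binom_def factorial_Suc [of N i] del: of_nat_Suc)
  ultimately show ?thesis
    by (simp add: binom_def add_divide_distrib distrib_right mult.assoc)
qed

lemma binom_le_choose:
  assumes "1 \<le> a" "0 < b" "b \<le> 1"
  shows "binom i j \<le> a ^ (i * j) * real (i + j choose i)"
proof (induction i arbitrary: j)
  case (Suc i)
  note IH_i = Suc
  show ?case
  proof (induction j)
    case (Suc j)
    have "a ^ Suc i * binom (Suc i) j \<le> a ^ Suc i * (a ^ (Suc i * j) * real (Suc i + j choose Suc i))"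
      using Suc assms by (intro mult_left_mono) auto
    also have "\<dots> = a ^ (Suc i * Suc j) * real (Suc i + j choose Suc i)"
      by (simp add: power_add algebra_simps)
    finally have 1: "a ^ Suc i * binom (Suc i) j \<le> a ^ (Suc i * Suc j) * real (Suc i + j choose Suc i)" .
    have "b ^ Suc j * binom i (Suc j) \<le> 1 * binom i (Suc j)"
      using assms less_imp_le [OF binom_pos] by (intro mult_right_mono power_le_one) auto
    also have "\<dots> \<le> a ^ (i * Suc j) * real (i + Suc j choose i)"
      by (simp only: mult_1 IH_i)
    also have "\<dots> \<le> a ^ (Suc i * Suc j) * real (i + Suc j choose i)"
      using assms by (intro mult_right_mono power_increasing) auto
    finally have 2: "b ^ Suc j * binom i (Suc j) \<le> a ^ (Suc i * Suc j) * real (i + Suc j choose i)" .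
    have "real (Suc i + Suc j choose Suc i) = real (i + Suc j choose i) + real (Suc i + j choose Suc i)"
      by simp
    with 1 2 show ?case by (simp only: binom_Suc_Suc distrib_left)
  qed simp
qed simp

lemma falling_eq_factorial: "falling N (int (v + m)) m = factorial N (v + m) / factorial N v"
proof (induction m)
  case 0
  show ?case using factorial_pos [of v] by simp
next
  case (Suc m)
  have "falling N (int (v + Suc m)) (Suc m) = N (int (Suc (v + m))) * falling N (int (v + m)) m"
    by (simp add: falling_Suc)
  then show ?case by (simp only: Suc factorial_Suc add_Suc_right times_divide_eq_right)
qed

lemma trinomial_eq_binom:
  "trinomial N (Suc n + i + j - 1) i j = binom i (n + j) * binom j n"
  using factorial_pos [of "n + j"]
  by (simp add: trinomial_def binom_def add.commute add.left_commute)

lemma neg_trinomial_mass_1: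
  "neg_trinomial_mass N a b (Suc 0) \<alpha>\<^sub>1 \<alpha>\<^sub>2 i j
    = binom i j * \<alpha>\<^sub>1 ^ i * \<alpha>\<^sub>2 ^ j * (a * b) ^ ((i choose 2) + (j choose 2))
      / (oplus_power a b 1 \<alpha>\<^sub>1 (Suc (i + j)) * oplus_power a b 1 \<alpha>\<^sub>2 (Suc j))"
  using trinomial_eq_binom [of 0 i j]
  by (simp add: neg_trinomial_mass_def choose_two_one_minus choose_two_of_nat power_mult_distrib
      flip: of_nat_add)

end

section \<open>Normalization of the trinomial family\<close>

context deformed_numbers
begin

text \<open>For small \<open>\<alpha>\<close>, the masses at \<open>(1, 0)\<close> and \<open>(2, 0)\<close> have the signs of \<open>a\<close> and
  of \<open>a * b\<close> (given \<open>0 < a\<close>).\<close>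

lemma family_signs:
  assumes "neg_trinomial_family N a b" "a \<noteq> 0" "b \<noteq> 0"
  shows "0 < a" "0 < b"
proof -
  \<comment> \<open>Small enough for \<open>a + \<alpha> * b\<close> to have the sign of \<open>a\<close>.\<close>
  define \<alpha> where "\<alpha> = \<bar>a\<bar> / (\<bar>a\<bar> + \<bar>b\<bar>)"
  have \<alpha>: "0 < \<alpha>" "\<alpha> < 1" using assms by (auto simp: \<alpha>_def field_simps)
  have "\<alpha> * \<bar>b\<bar> < \<bar>a\<bar>"
    using assms by (auto simp: \<alpha>_def field_simps zero_less_mult_iff)
  then have lt: "\<bar>\<alpha> * b\<bar> < \<bar>a\<bar>" using \<alpha> by (simp add: abs_mult)
  have nonneg: "0 \<le> neg_trinomial_mass N a b 1 \<alpha> \<alpha> i 0" for i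
    using assms(1) \<alpha> unfolding neg_trinomial_family_def by auto
  have "0 \<le> \<alpha> / ((1 + \<alpha>) * (a + \<alpha> * b) * (1 + \<alpha>))"
    using nonneg [of 1] by (simp add: neg_trinomial_mass_1 oplus_power_Suc)
  moreover have "a + \<alpha> * b \<noteq> 0" using lt by auto
  ultimately have pos: "0 < a + \<alpha> * b"
    using \<alpha> by (auto simp: zero_le_divide_iff zero_le_mult_iff)
  then show "0 < a" using lt by auto
  have "0 \<le> \<alpha>\<^sup>2 * (a * b) / ((1 + \<alpha>) * (a + \<alpha> * b) * (a\<^sup>2 + \<alpha> * b\<^sup>2) * (1 + \<alpha>))"
    using nonneg [of 2] by (simp add: neg_trinomial_mass_1 oplus_power_Suc numeral_2_eq_2)
  moreover have "0 < (1 + \<alpha>) * (a + \<alpha> * b) * (a\<^sup>2 + \<alpha> * b\<^sup>2) * (1 + \<alpha>)"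
    using pos \<alpha> add_pos_nonneg [of "a\<^sup>2" "\<alpha> * b\<^sup>2"] assms by (intro mult_pos_pos) auto
  ultimately have "0 \<le> \<alpha>\<^sup>2 * (a * b)" by (simp add: zero_le_divide_iff)
  then show "0 < b" using \<open>0 < a\<close> \<alpha> assms by (auto simp: zero_le_mult_iff)
qed

text \<open>To first order in \<open>\<alpha>\<^sub>1\<close>, and for much smaller \<open>\<alpha>\<^sub>2\<close>, the masses at \<open>(0, 0)\<close> and
  \<open>(1, 0)\<close> add up to \<open>1 - \<alpha>\<^sub>1 + \<alpha>\<^sub>1 / a\<close>, which would exceed \<open>1\<close> for \<open>a < 1\<close>. The choice
  \<open>\<alpha>\<^sub>2 = \<alpha>\<^sub>1\<^sup>2\<close> is small enough.\<close>

lemma family_imp_a_ge_1: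
  assumes fam: "neg_trinomial_family N a b" and a: "0 < a" and b: "0 < b"
  shows "1 \<le> a"
proof -
  have "1 \<le> (a + \<alpha> * b) * (1 + \<alpha> + \<alpha>\<^sup>2)" if \<alpha>: "\<alpha> \<in> {0<..<1}" for \<alpha> :: real
  proof -
    have \<alpha>2: "\<alpha>\<^sup>2 \<in> {0<..<1}" using \<alpha> by (auto simp: power_less_one_iff)
    let ?f = "neg_trinomial_mass N a b 1 \<alpha> (\<alpha>\<^sup>2)"
    have fs: "((\<lambda>(i, j). ?f i j) has_sum 1) UNIV" and nn: "\<And>i j. 0 \<le> ?f i j"
      using fam \<alpha> \<alpha>2 unfolding neg_trinomial_family_def by auto
    have "sum (\<lambda>(i, j). ?f i j) {(0, 0), (1, 0)} \<le> 1"
      by (rule finite_sum_le_has_sum [OF fs]) (use nn in auto)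
    then have "1 / ((1 + \<alpha>) * (1 + \<alpha>\<^sup>2)) + \<alpha> / ((1 + \<alpha>) * (a + \<alpha> * b) * (1 + \<alpha>\<^sup>2)) \<le> 1"
      by (simp add: neg_trinomial_mass_1 oplus_power_Suc)
    moreover have "0 < a + \<alpha> * b" "0 < 1 + \<alpha>" "0 < 1 + \<alpha>\<^sup>2"
      using a b \<alpha> \<alpha>2 by (auto intro: add_pos_pos)
    ultimately have "a + \<alpha> * b + \<alpha> \<le> (1 + \<alpha>) * (a + \<alpha> * b) * (1 + \<alpha>\<^sup>2)"
      by (simp add: divide_simps)
    also have "\<dots> = a + \<alpha> * b + \<alpha> * ((a + \<alpha> * b) * (1 + \<alpha> + \<alpha>\<^sup>2))"
      by (simp add: algebra_simps power2_eq_square)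
    finally have "\<alpha> * 1 \<le> \<alpha> * ((a + \<alpha> * b) * (1 + \<alpha> + \<alpha>\<^sup>2))" by simp
    then show ?thesis using \<alpha> by (simp only: mult_le_cancel_left_pos greaterThanLessThan_iff)
  qed
  then have "eventually (\<lambda>\<alpha>. 1 \<le> (a + \<alpha> * b) * (1 + \<alpha> + \<alpha>\<^sup>2)) (at_right 0)"
    using eventually_at_right_real [of 0 1] by (auto elim: eventually_mono)
  moreover have "((\<lambda>\<alpha>. (a + \<alpha> * b) * (1 + \<alpha> + \<alpha>\<^sup>2)) \<longlongrightarrow> (a + 0 * b) * (1 + 0 + 0\<^sup>2)) (at_right 0)"
    by (intro tendsto_intros)
  ultimately have "1 \<le> (a + 0 * b) * (1 + 0 + 0\<^sup>2)"
    by (intro tendsto_lowerbound) auto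
  then show ?thesis by simp
qed

text \<open>If both bases exceed \<open>1\<close>, the masses at \<open>(w, 0)\<close> for \<open>n = 1\<close> eventually increase with
  \<open>w\<close>: with \<open>c = min a b\<close> and \<open>d = max a b\<close>, the quotient of consecutive masses is at least
  \<open>c ^ w / (4 * d)\<close>.\<close>

lemma family_imp_b_le_1:
  assumes fam: "neg_trinomial_family N a b" and a: "1 < a"
  shows "b \<le> 1"
proof (rule ccontr)
  assume "\<not> b \<le> 1"
  then have b: "1 < b" by simp
  define c d where "c = min a b" and "d = max a b"
  have cd: "1 < c" "1 < d" "a * b = c * d" "a \<le> d" "b \<le> d"
    using a b by (auto simp: c_def d_def min_def max_def)
  define f where "f = (\<lambda>(i, j). neg_trinomial_mass N a b 1 (1/2) (1/2) i j)"
  have fs: "(f has_sum 1) UNIV" and nn: "\<And>x. 0 \<le> f x"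
    using fam unfolding neg_trinomial_family_def f_def by auto
  have oplus_pos: "0 < oplus_power a b 1 (1/2) k" for k
    using a b by (induction k) (auto simp: oplus_power_Suc intro!: mult_pos_pos add_pos_pos)
  have step: "f (Suc w, 0) = f (w, 0) * ((a * b) ^ w / (2 * a ^ Suc w + b ^ Suc w))" for w
  proof -
    define P X where "P = oplus_power a b 1 (1/2) (Suc w)" and "X = 2 * a ^ Suc w + b ^ Suc w"
    have "0 < X" "0 < P" using a b oplus_pos by (auto simp: P_def X_def intro!: add_pos_pos)
    have P: "oplus_power a b 1 (1/2) (Suc (Suc w)) = P * X / 2"
      unfolding P_def X_def by (subst oplus_power_Suc) (simp add: field_simps)
    have "f (Suc w, 0) = (1/2) ^ Suc w * (a * b) ^ ((w choose 2) + w) / (P * X / 2 * oplus_power a b 1 (1/2) (Suc 0))"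
      by (simp only: f_def prod.case One_nat_def neg_trinomial_mass_1 P add_0_right)
        (simp add: Suc_choose_two)
    moreover have "f (w, 0) = (1/2) ^ w * (a * b) ^ (w choose 2) / (P * oplus_power a b 1 (1/2) (Suc 0))"
      by (simp add: f_def neg_trinomial_mass_1 P_def)
    ultimately show ?thesis
      using \<open>0 < X\<close> \<open>0 < P\<close> by (simp only: X_def [symmetric]) (simp add: power_add mult_ac)
  qed
  have f_pos: "0 < f (w, 0)" for w
    using a b oplus_pos
    by (auto simp: f_def neg_trinomial_mass_1 intro!: divide_pos_pos mult_pos_pos)
  obtain w\<^sub>0 where w\<^sub>0: "4 * d < c ^ w\<^sub>0" using real_arch_pow [OF cd(1)] by blast
  have inc: "f (w\<^sub>0, 0) \<le> f (w\<^sub>0 + k, 0)" for k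
  proof (induction k)
    case (Suc k)
    let ?w = "w\<^sub>0 + k"
    have "2 * a ^ Suc ?w + b ^ Suc ?w \<le> 4 * d ^ Suc ?w"
      using power_mono [of a d "Suc ?w"] power_mono [of b d "Suc ?w"] zero_le_power [of d "Suc ?w"] a b cd
      by linarith
    also have "\<dots> = (4 * d) * d ^ ?w" by simp
    also have "\<dots> \<le> c ^ ?w * d ^ ?w"
    proof (rule mult_right_mono)
      have "4 * d \<le> c ^ w\<^sub>0" using w\<^sub>0 by simp
      also have "\<dots> \<le> c ^ ?w" using cd by (intro power_increasing) auto
      finally show "4 * d \<le> c ^ ?w" .
    qed (use cd in auto)
    also have "\<dots> = (a * b) ^ ?w" by (simp add: cd power_mult_distrib)
    finally have "2 * a ^ Suc ?w + b ^ Suc ?w \<le> (a * b) ^ ?w" .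
    moreover have "0 < 2 * a ^ Suc ?w + b ^ Suc ?w" using a b by (intro add_pos_pos) auto
    ultimately have "1 \<le> (a * b) ^ ?w / (2 * a ^ Suc ?w + b ^ Suc ?w)"
      by (simp only: le_divide_eq_1_pos)
    then have "f (?w, 0) * 1 \<le> f (Suc ?w, 0)"
      unfolding step using nn by (intro mult_left_mono) auto
    then show ?case using Suc by simp
  qed simp
  obtain K where K: "1 < real K * f (w\<^sub>0, 0)" using reals_Archimedean3 [OF f_pos] by blast
  have "real K * f (w\<^sub>0, 0) \<le> (\<Sum>k<K. f (w\<^sub>0 + k, 0))"
    using sum_bounded_below [of "{..<K}" "f (w\<^sub>0, 0)" "\<lambda>k. f (w\<^sub>0 + k, 0)"] inc by simp
  also have "\<dots> = sum f ((\<lambda>k. (w\<^sub>0 + k, 0)) ` {..<K})"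
    by (subst sum.reindex) (auto simp: inj_on_def)
  also have "\<dots> \<le> 1" by (rule finite_sum_le_has_sum [OF fs]) (use nn in auto)
  finally show False using K by simp
qed

lemma oplus_power_ge:
  assumes "1 \<le> a" "0 < b" "0 < \<alpha>"
  shows "(1 + \<alpha>) * a ^ (Suc k choose 2) \<le> oplus_power a b 1 \<alpha> (Suc k)"
proof (induction k)
  case (Suc k)
  have "(1 + \<alpha>) * a ^ (Suc (Suc k) choose 2) = ((1 + \<alpha>) * a ^ (Suc k choose 2)) * a ^ Suc k"
    by (simp only: Suc_choose_two [of "Suc k"] power_add mult.assoc)
  also have "\<dots> \<le> oplus_power a b 1 \<alpha> (Suc k) * (1 * a ^ Suc k + \<alpha> * b ^ Suc k)"
    using assms by (intro mult_mono Suc order_trans [OF _ Suc]) auto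
  finally show ?case by (simp only: oplus_power_Suc)
qed (simp add: oplus_power_Suc)

text \<open>For \<open>b \<le> 1 < a\<close> the masses for \<open>n = 1\<close> and \<open>\<alpha>\<^sub>1 = \<alpha>\<^sub>2 = \<alpha>\<close> are dominated by
  the terms of a multiple of the series \<open>\<Sum>\<^sub>k (2 * \<alpha> / a) ^ k\<close>, expanded by the binomial
  theorem.\<close>

lemma mass_le_binomial_term:
  assumes a: "1 \<le> a" and b: "0 < b" "b \<le> 1" and \<alpha>: "0 < \<alpha>"
  shows "neg_trinomial_mass N a b 1 \<alpha> \<alpha> i j
    \<le> real (i + j choose i) * (\<alpha> / a) ^ (i + j) / (1 + \<alpha>)\<^sup>2"
proof -
  define e where "e = i * j + ((i choose 2) + (j choose 2))"
  have e: "Suc (i + j) choose 2 = e + (i + j)"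
  proof -
    have "Suc (i + j) choose 2 = i * j + ((i choose 2) + (j choose 2)) + (i + j)"
    proof (induction j)
      case (Suc j)
      have "Suc (i + Suc j) choose 2 = (Suc (i + j) choose 2) + Suc (i + j)"
        using Suc_choose_two [of "Suc (i + j)"] by (simp only: add_Suc_right)
      then show ?case unfolding Suc by (simp only: Suc_choose_two [of j]) simp
    qed (simp add: Suc_choose_two)
    then show ?thesis by (simp only: e_def)
  qed
  have "binom i j * (a * b) ^ ((i choose 2) + (j choose 2))
      \<le> (a ^ (i * j) * real (i + j choose i)) * a ^ ((i choose 2) + (j choose 2))"
    using a b by (intro mult_mono binom_le_choose power_mono) (auto simp: mult_left_le)
  also have "\<dots> = real (i + j choose i) * a ^ e" by (simp add: e_def power_add)
  finally have num: "binom i j * (a * b) ^ ((i choose 2) + (j choose 2)) \<le> real (i + j choose i) * a ^ e" .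
  have "(1 + \<alpha>) * a ^ (e + (i + j)) \<le> oplus_power a b 1 \<alpha> (Suc (i + j))"
    using oplus_power_ge [OF a b(1) \<alpha>, of "i + j"] by (simp add: e)
  moreover have "1 + \<alpha> \<le> oplus_power a b 1 \<alpha> (Suc j)"
  proof -
    have "(1 + \<alpha>) * 1 \<le> (1 + \<alpha>) * a ^ (Suc j choose 2)"
      using a \<alpha> by (intro mult_left_mono one_le_power) auto
    also have "\<dots> \<le> oplus_power a b 1 \<alpha> (Suc j)" by (rule oplus_power_ge [OF a b(1) \<alpha>])
    finally show ?thesis by simp
  qed
  ultimately have den: "((1 + \<alpha>) * a ^ (e + (i + j))) * (1 + \<alpha>)
      \<le> oplus_power a b 1 \<alpha> (Suc (i + j)) * oplus_power a b 1 \<alpha> (Suc j)"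
    using a \<alpha> by (intro mult_mono) (auto intro: order_trans [rotated])
  have "neg_trinomial_mass N a b 1 \<alpha> \<alpha> i j
      = (binom i j * (a * b) ^ ((i choose 2) + (j choose 2))) * \<alpha> ^ (i + j)
        / (oplus_power a b 1 \<alpha> (Suc (i + j)) * oplus_power a b 1 \<alpha> (Suc j))"
    by (simp add: neg_trinomial_mass_1 power_add mult.assoc mult.left_commute)
  also have "\<dots> \<le> (real (i + j choose i) * a ^ e) * \<alpha> ^ (i + j) / (((1 + \<alpha>) * a ^ (e + (i + j))) * (1 + \<alpha>))"
    using a b \<alpha> by (intro frac_le mult_right_mono num den mult_nonneg_nonneg mult_pos_pos) auto
  also have "\<dots> = real (i + j choose i) * (\<alpha> / a) ^ (i + j) / (1 + \<alpha>)\<^sup>2"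
    using a \<alpha> by (simp add: power_add power_divide power2_eq_square)
  finally show ?thesis .
qed

lemma family_imp_not_b_le_1:
  assumes fam: "neg_trinomial_family N a b" and a: "1 < a" and b: "0 < b" "b \<le> 1"
  shows False
proof -
  \<comment> \<open>Small enough for \<open>(1 + \<alpha>)\<^sup>2 * (1 - 2 * \<alpha> / a) > 1\<close>.\<close>
  define \<alpha> where "\<alpha> = min (1/2) ((a - 1) / 4)"
  have \<alpha>: "0 < \<alpha>" "\<alpha> < 1" "4 * \<alpha> \<le> a - 1" "2 * \<alpha> < a"
    using a by (auto simp: \<alpha>_def min_def)
  define f where "f = (\<lambda>(i, j). neg_trinomial_mass N a b 1 \<alpha> \<alpha> i j)"
  have fs: "(f has_sum 1) UNIV" and nn: "\<And>x. 0 \<le> f x"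
    using fam \<alpha> unfolding neg_trinomial_family_def f_def by auto
  define x where "x = \<alpha> / a"
  have x: "0 < x" "2 * x < 1" using \<alpha> a by (auto simp: x_def field_simps)
  have "1 \<le> 1 / (1 - 2 * x) / (1 + \<alpha>)\<^sup>2"
  proof (rule has_sum_le_finite_sums [OF fs])
    fix F :: "(nat \<times> nat) set" assume F: "finite F"
    define K where "K = Max ((\<lambda>(i, j). i + j) ` F)"
    have "F \<subseteq> {(i, j). i + j \<le> K}"
      using F by (auto simp: K_def intro!: Max_ge rev_image_eqI)
    moreover have "finite {(i, j). i + j \<le> K}"
      by (rule finite_subset [of _ "{..K} \<times> {..K}"]) auto
    ultimately have "sum f F \<le> sum f {(i, j). i + j \<le> K}"
      using nn by (intro sum_mono2) auto
    also have "\<dots> = (\<Sum>k\<le>K. \<Sum>i\<le>k. f (i, k - i))"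
      using sum.triangle_reindex_eq [of "\<lambda>i j. f (i, j)" K] by simp
    also have "\<dots> \<le> (\<Sum>k\<le>K. \<Sum>i\<le>k. real (k choose i) * x ^ k / (1 + \<alpha>)\<^sup>2)"
    proof (intro sum_mono)
      fix k i :: nat assume "i \<in> {..k}"
      then show "f (i, k - i) \<le> real (k choose i) * x ^ k / (1 + \<alpha>)\<^sup>2"
        using mass_le_binomial_term [of \<alpha> i "k - i"] a b \<alpha> by (simp add: f_def x_def)
    qed
    also have "\<dots> = (\<Sum>k\<le>K. real (\<Sum>i\<le>k. k choose i) * x ^ k / (1 + \<alpha>)\<^sup>2)"
      by (simp add: sum_distrib_right sum_divide_distrib)
    also have "\<dots> = (\<Sum>k\<le>K. (2 * x) ^ k) / (1 + \<alpha>)\<^sup>2"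
      by (simp only: choose_row_sum) (simp add: power_mult_distrib sum_divide_distrib)
    also have "(\<Sum>k\<le>K. (2 * x) ^ k) \<le> (\<Sum>k. (2 * x) ^ k)"
      using x by (intro sum_le_suminf summable_geometric) auto
    also have "(\<Sum>k. (2 * x) ^ k) = 1 / (1 - 2 * x)"
      using x by (intro suminf_geometric) auto
    finally show "sum f F \<le> 1 / (1 - 2 * x) / (1 + \<alpha>)\<^sup>2"
      using \<alpha> by (simp add: divide_right_mono)
  qed
  then have "(1 - 2 * x) * (1 + \<alpha>)\<^sup>2 \<le> 1" using x \<alpha> by (simp add: field_simps)
  moreover have "(1 - 2 * x) * (1 + 2 * \<alpha>) \<le> (1 - 2 * x) * (1 + \<alpha>)\<^sup>2"
    using x by (intro mult_left_mono) (auto simp: power2_eq_square algebra_simps)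
  moreover have "1 < (1 - 2 * x) * (1 + 2 * \<alpha>)"
  proof -
    have "\<alpha> * (1 + 2 * \<alpha>) < \<alpha> * a" using \<alpha> by (intro mult_strict_left_mono) auto
    then have "x * (1 + 2 * \<alpha>) < \<alpha>" using a by (simp add: x_def field_simps)
    then show ?thesis by (simp add: algebra_simps)
  qed
  ultimately show False by linarith
qed

lemma family_imp_a_eq_1:
  assumes "neg_trinomial_family N a b" "a \<noteq> 0" "b \<noteq> 0"
  shows "a = 1"
  using family_signs [OF assms] family_imp_a_ge_1 [OF assms(1)]
    family_imp_b_le_1 [OF assms(1)] family_imp_not_b_le_1 [OF assms(1)]
  by fastforce

end

section \<open>The negative binomial distribution for \<open>a = 1\<close>\<close>

locale q_numbers = deformed_numbers N 1 Q for N :: "int \<Rightarrow> real" and Q :: real +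
  assumes Q_pos: "0 < Q"
begin

text \<open>The masses come from independent trials in which the trial after \<open>k\<close> earlier ones succeeds with odds
  \<open>\<alpha> * Q ^ k\<close>. The probability that \<open>i\<close> successes and \<open>j\<close> failures occur in the first
  \<open>i + j\<close> trials is given by the first definition, and the probability that exactly \<open>i\<close>
  successes occur before the failure number \<open>j + 1\<close> by the second one.\<close>

definition visit :: "real \<Rightarrow> nat \<Rightarrow> nat \<Rightarrow> real" where
  "visit \<alpha> i j = binom i j * \<alpha> ^ i * Q ^ (i choose 2) / oplus_power 1 Q 1 \<alpha> (i + j)"

definition negbin :: "real \<Rightarrow> nat \<Rightarrow> nat \<Rightarrow> real" where
  "negbin \<alpha> j i = visit \<alpha> i j / (1 + \<alpha> * Q ^ (i + j))"

definition visit_then_success :: "real \<Rightarrow> nat \<Rightarrow> nat \<Rightarrow> real" where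
  "visit_then_success \<alpha> i j = visit \<alpha> i j * (\<alpha> * Q ^ (i + j)) / (1 + \<alpha> * Q ^ (i + j))"

lemma odds_pos: "0 < \<alpha> \<Longrightarrow> 0 < 1 + \<alpha> * Q ^ k"
  using Q_pos by (simp add: add_pos_pos)

lemma oplus_power_pos: "0 < \<alpha> \<Longrightarrow> 0 < oplus_power 1 Q 1 \<alpha> k"
  by (induction k) (auto simp: oplus_power_Suc odds_pos)

lemma negbin_eq:
  "negbin \<alpha> j i = binom i j * \<alpha> ^ i * Q ^ (i choose 2) / oplus_power 1 Q 1 \<alpha> (Suc (i + j))"
  by (simp add: negbin_def visit_def oplus_power_Suc)

lemma neg_trinomial_mass_eq:
  "neg_trinomial_mass N 1 Q (Suc n) \<alpha>\<^sub>1 \<alpha>\<^sub>2 i j = negbin \<alpha>\<^sub>1 (n + j) i * negbin \<alpha>\<^sub>2 n j"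
  unfolding neg_trinomial_mass_def trinomial_eq_binom negbin_eq
  by (simp add: choose_two_of_nat power_add add_ac flip: of_nat_add)

lemma visit_pos: "0 < \<alpha> \<Longrightarrow> 0 < visit \<alpha> i j"
  by (auto simp: visit_def Q_pos binom_pos oplus_power_pos)

lemma negbin_pos: "0 < \<alpha> \<Longrightarrow> 0 < negbin \<alpha> j i"
  by (simp add: negbin_def visit_pos odds_pos)

lemma visit_then_success_nonneg: "0 < \<alpha> \<Longrightarrow> 0 \<le> visit_then_success \<alpha> i j"
  using visit_pos [of \<alpha> i j] odds_pos [of \<alpha> "i + j"] Q_pos by (simp add: visit_then_success_def)

lemma visit_leave:
  assumes "0 < \<alpha>"
  shows "visit \<alpha> i j = negbin \<alpha> j i + visit_then_success \<alpha> i j"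
  using odds_pos [OF assms, of "i + j"]
  by (simp add: negbin_def visit_then_success_def divide_simps) (simp add: algebra_simps)

text \<open>A state is entered by a failure or by a success; for the general state this is the recursion
  for the deformed binomial coefficients.\<close>

lemma visit_enter:
  assumes "0 < \<alpha>"
  shows "visit \<alpha> 0 0 = 1"
    and "visit \<alpha> (Suc i) 0 = visit_then_success \<alpha> i 0"
    and "visit \<alpha> 0 (Suc j) = negbin \<alpha> j 0"
    and "visit \<alpha> (Suc i) (Suc j) = negbin \<alpha> j (Suc i) + visit_then_success \<alpha> i (Suc j)"
proof -
  show "visit \<alpha> 0 0 = 1" by (simp add: visit_def)
  show "visit \<alpha> (Suc i) 0 = visit_then_success \<alpha> i 0"
    by (simp add: visit_def visit_then_success_def oplus_power_Suc Suc_choose_two power_add)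
  show "visit \<alpha> 0 (Suc j) = negbin \<alpha> j 0"
    by (simp add: visit_def negbin_def oplus_power_Suc)
  show "visit \<alpha> (Suc i) (Suc j) = negbin \<alpha> j (Suc i) + visit_then_success \<alpha> i (Suc j)"
    by (simp add: visit_def negbin_def visit_then_success_def oplus_power_Suc Suc_choose_two
        binom_Suc_Suc power_add flip: add_divide_distrib) (simp add: algebra_simps)
qed

text \<open>Both equations partition an event. The first one: either the first failure comes after at
  most \<open>k\<close> successes, or success number \<open>k + 1\<close> comes before any failure. The second one: if
  failure number \<open>n + 1\<close> comes after at most \<open>k\<close> successes, then either so does failure number
  \<open>n + 2\<close>, or success number \<open>k + 1\<close> comes between the two. Formally, this is conservation of
  probability at each state \<open>(i, j)\<close>: what enters it leaves it.\<close>

lemma negbin_flow: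
  assumes "0 < \<alpha>"
  shows "(\<Sum>i\<le>k. negbin \<alpha> 0 i) + visit_then_success \<alpha> k 0 = 1"
    and "(\<Sum>i\<le>k. negbin \<alpha> (Suc n) i) + visit_then_success \<alpha> k (Suc n) = (\<Sum>i\<le>k. negbin \<alpha> n i)"
proof -
  show "(\<Sum>i\<le>k. negbin \<alpha> 0 i) + visit_then_success \<alpha> k 0 = 1"
  proof (induction k)
    case 0
    show ?case using visit_leave [OF assms, of 0 0] visit_enter(1) [OF assms] by simp
  next
    case (Suc k)
    then show ?case using visit_leave [OF assms, of "Suc k" 0] visit_enter(2) [OF assms, of k] by simp
  qed
  show "(\<Sum>i\<le>k. negbin \<alpha> (Suc n) i) + visit_then_success \<alpha> k (Suc n) = (\<Sum>i\<le>k. negbin \<alpha> n i)"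
  proof (induction k)
    case 0
    show ?case using visit_leave [OF assms, of 0 "Suc n"] visit_enter(3) [OF assms, of n] by simp
  next
    case (Suc k)
    then show ?case
      using visit_leave [OF assms, of "Suc k" "Suc n"] visit_enter(4) [OF assms, of k n] by simp
  qed
qed

lemma sum_negbin_le_1:
  assumes "0 < \<alpha>"
  shows "(\<Sum>i\<le>k. negbin \<alpha> n i) \<le> 1"
proof (induction n)
  case 0
  show ?case using negbin_flow(1) [OF assms, of k] visit_then_success_nonneg [OF assms, of k 0] by simp
next
  case (Suc n)
  then show ?case
    using negbin_flow(2) [OF assms, of n k] visit_then_success_nonneg [OF assms, of k "Suc n"] by simp
qed

text \<open>The trinomial masses are \<open>negbin \<alpha> (n + j) i * negbin \<alpha> n j\<close>. Neither factor has
  a sum above \<open>1\<close>, so a total mass of \<open>1\<close> leaves no room for a deficit in the sum over \<open>i\<close> for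
  \<open>j = 0\<close>.\<close>

lemma negbin_sums_1:
  assumes fam: "neg_trinomial_family N 1 Q" and \<alpha>: "0 < \<alpha>" "\<alpha> < 1"
  shows "negbin \<alpha> n sums 1"
proof -
  define S where "S = (\<Sum>i. negbin \<alpha> n i)"
  have nn: "0 \<le> negbin \<alpha> m i" for m i using negbin_pos [OF \<alpha>(1)] by (rule less_imp_le)
  have partial: "(\<Sum>i<k. negbin \<alpha> n i) \<le> 1" for k
    using sum_negbin_le_1 [OF \<alpha>(1), of n k] nn [of n k] by (simp flip: lessThan_Suc_atMost)
  have summ: "summable (negbin \<alpha> n)"
    by (rule summableI_nonneg_bounded [OF nn partial])
  have "S \<le> 1"
    unfolding S_def by (rule suminf_le_const [OF summ partial])
  have "\<alpha> \<in> {0<..<1}" using \<alpha> by simp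
  then have "((\<lambda>(i, j). neg_trinomial_mass N 1 Q (Suc n) \<alpha> \<alpha> i j) has_sum 1) UNIV"
    using fam unfolding neg_trinomial_family_def by auto
  then have fs: "((\<lambda>(i, j). negbin \<alpha> (n + j) i * negbin \<alpha> n j) has_sum 1) UNIV"
    by (simp only: neg_trinomial_mass_eq)
  have "1 \<le> 1 - negbin \<alpha> n 0 * (1 - S)"
  proof (rule has_sum_le_finite_sums [OF fs])
    fix F :: "(nat \<times> nat) set" assume F: "finite F"
    define K where "K = Max (fst ` F \<union> snd ` F \<union> {0})"
    have "F \<subseteq> {..K} \<times> {..K}"
      using F by (auto simp: K_def intro!: Max_ge intro: rev_image_eqI)
    then have "(\<Sum>(i, j)\<in>F. negbin \<alpha> (n + j) i * negbin \<alpha> n j)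
        \<le> (\<Sum>(i, j)\<in>{..K} \<times> {..K}. negbin \<alpha> (n + j) i * negbin \<alpha> n j)"
      using nn by (intro sum_mono2) auto
    also have "\<dots> = (\<Sum>j\<le>K. (\<Sum>i\<le>K. negbin \<alpha> (n + j) i) * negbin \<alpha> n j)"
      by (simp add: sum.cartesian_product [symmetric] sum_distrib_right) (rule sum.swap)
    also have "\<dots> \<le> (\<Sum>j\<le>K. negbin \<alpha> n j - (if j = 0 then negbin \<alpha> n 0 * (1 - S) else 0))"
    proof (rule sum_mono)
      fix j
      have "(\<Sum>i\<le>K. negbin \<alpha> (n + j) i) * negbin \<alpha> n j \<le> 1 * negbin \<alpha> n j"
        by (intro mult_right_mono sum_negbin_le_1 \<alpha> nn)
      moreover have "(\<Sum>i\<le>K. negbin \<alpha> n i) * negbin \<alpha> n 0 \<le> S * negbin \<alpha> n 0"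
        unfolding S_def by (intro mult_right_mono sum_le_suminf summ nn) auto
      ultimately show "(\<Sum>i\<le>K. negbin \<alpha> (n + j) i) * negbin \<alpha> n j
          \<le> negbin \<alpha> n j - (if j = 0 then negbin \<alpha> n 0 * (1 - S) else 0)"
        by (auto simp: algebra_simps)
    qed
    also have "\<dots> = (\<Sum>j\<le>K. negbin \<alpha> n j) - negbin \<alpha> n 0 * (1 - S)"
      by (simp add: sum_subtractf)
    also have "\<dots> \<le> 1 - negbin \<alpha> n 0 * (1 - S)"
      using sum_negbin_le_1 [OF \<alpha>(1)] by simp
    finally show "(\<Sum>(i, j)\<in>F. negbin \<alpha> (n + j) i * negbin \<alpha> n j) \<le> 1 - negbin \<alpha> n 0 * (1 - S)" .
  qed
  then have "negbin \<alpha> n 0 * (1 - S) \<le> 0" by simp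
  then have "1 \<le> S" using negbin_pos [OF \<alpha>(1), of n 0] by (simp add: mult_le_0_iff)
  with \<open>S \<le> 1\<close> have "S = 1" by simp
  then show ?thesis using summable_sums [OF summ] by (simp add: S_def)
qed

section \<open>Factorial moments\<close>

definition inv_number :: "int \<Rightarrow> real" where
  "inv_number x = Q powi (1 - x) * N x"

lemma falling_inv_number:
  "falling inv_number (int (v + m)) m * Q ^ (v + m choose 2)
    = falling N (int (v + m)) m * Q ^ (v choose 2)"
proof (induction m)
  case (Suc m)
  have num: "inv_number (int (Suc (v + m))) * Q ^ (v + m) = N (int (Suc (v + m)))"
  proof -
    have "Q powi (1 - int (Suc (v + m))) = inverse (Q ^ (v + m))"
      by (simp add: power_int_minus [symmetric] flip: power_int_of_nat)
    then show ?thesis using Q_pos by (simp add: inv_number_def)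
  qed
  have "falling inv_number (int (v + Suc m)) (Suc m) * Q ^ (v + Suc m choose 2)
      = (inv_number (int (Suc (v + m))) * Q ^ (v + m))
        * (falling inv_number (int (v + m)) m * Q ^ (v + m choose 2))"
    by (simp only: falling_Suc add_Suc_right Suc_choose_two power_add) simp
  also have "\<dots> = falling N (int (v + Suc m)) (Suc m) * Q ^ (v choose 2)"
    unfolding num Suc by (simp add: falling_Suc)
  finally show ?case .
qed simp

lemma falling_inv_number_eq_0: "w < m \<Longrightarrow> falling inv_number (int w) m = 0"
  by (rule falling_eq_0) (simp_all add: inv_number_def)

lemma falling_inv_number_nonneg: "0 \<le> falling inv_number (int w) m"
proof (cases "w < m")
  case False
  then obtain v where w: "w = v + m" by (metis add.commute le_Suc_ex not_less)
  have "0 \<le> falling inv_number (int w) m * Q ^ (w choose 2)"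
    unfolding w falling_inv_number falling_eq_factorial
    using factorial_pos [of "v + m"] factorial_pos [of v] Q_pos by simp
  moreover have "0 < Q ^ (w choose 2)" using Q_pos by simp
  ultimately show ?thesis by (simp only: zero_le_mult_iff) linarith
qed (simp add: falling_inv_number_eq_0)

text \<open>The powers of \<open>Q\<close> in the inverted numbers are what turns \<open>Q ^ (v + m choose 2)\<close> into
  \<open>Q ^ (v choose 2)\<close>, so that the weighted mass is again a negative binomial mass, with \<open>m\<close> more
  failures.\<close>

lemma falling_inv_number_negbin:
  "falling inv_number (int (v + m)) m * negbin \<alpha> n (v + m)
    = \<alpha> ^ m * falling N (int (n + m)) m * negbin \<alpha> (n + m) v"
proof -
  have "falling inv_number (int (v + m)) m * negbin \<alpha> n (v + m)
      = (falling inv_number (int (v + m)) m * Q ^ (v + m choose 2)) * binom (v + m) n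
        * \<alpha> ^ (v + m) / oplus_power 1 Q 1 \<alpha> (Suc (v + m + n))"
    by (simp add: negbin_eq)
  also have "\<dots> = (falling N (int (v + m)) m * binom (v + m) n)
        * \<alpha> ^ (v + m) * Q ^ (v choose 2) / oplus_power 1 Q 1 \<alpha> (Suc (v + m + n))"
    by (simp only: falling_inv_number) simp
  also have "falling N (int (v + m)) m * binom (v + m) n
      = falling N (int (n + m)) m * binom v (n + m)"
    using factorial_pos [of "v + m"] factorial_pos [of "n + m"]
    unfolding falling_eq_factorial binom_def by (simp add: add_ac)
  finally show ?thesis by (simp add: negbin_eq power_add add_ac)
qed

lemma falling_inv_number_sums:
  assumes fam: "neg_trinomial_family N 1 Q" and \<alpha>: "0 < \<alpha>" "\<alpha> < 1"
  shows "(\<lambda>w. falling inv_number (int w) m * negbin \<alpha> n w) sums (\<alpha> ^ m * falling N (int (n + m)) m)"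
proof -
  have "(\<lambda>v. \<alpha> ^ m * falling N (int (n + m)) m * negbin \<alpha> (n + m) v)
      sums (\<alpha> ^ m * falling N (int (n + m)) m * 1)"
    by (intro sums_mult negbin_sums_1 assms)
  then have "(\<lambda>v. falling inv_number (int (v + m)) m * negbin \<alpha> n (v + m))
      sums (\<alpha> ^ m * falling N (int (n + m)) m)"
    by (simp only: falling_inv_number_negbin mult_1_right)
  then show ?thesis
    by (subst (asm) sums_zero_iff_shift) (simp_all add: falling_inv_number_eq_0)
qed

text \<open>The divisor in the mixed moments extends the denominator of the mass by \<open>m\<close> factors;
  together with the conditional moment of the first variable this again shifts the number of
  failures by \<open>m\<close>.\<close>

lemma falling_negbin_div_oplus_power:
  assumes "0 < \<alpha>"
  shows "falling N (int (n + j + m)) m * negbin \<alpha> n j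
      / oplus_power 1 Q (1 ^ (Suc n + j)) (\<alpha> * Q ^ (Suc n + j)) m
    = falling N (int (n + m)) m * negbin \<alpha> (n + m) j"
proof -
  have "falling N (int (n + j + m)) m * binom j n = falling N (int (n + m)) m * binom j (n + m)"
    using factorial_pos [of "n + j"] factorial_pos [of "n + m"]
    unfolding falling_eq_factorial binom_def by (simp add: add_ac)
  moreover have "oplus_power 1 Q 1 \<alpha> (Suc (j + (n + m)))
      = oplus_power 1 Q 1 \<alpha> (Suc (j + n)) * oplus_power 1 Q (1 ^ (Suc n + j)) (\<alpha> * Q ^ (Suc n + j)) m"
    using oplus_power_add [of 1 Q 1 \<alpha> "Suc (j + n)" m] by (simp add: add_ac)
  ultimately show ?thesis by (simp add: negbin_eq)
qed

lemma falling_add: "falling N (int (n + m\<^sub>1)) m\<^sub>1 * falling N (int (n + m\<^sub>1 + m\<^sub>2)) m\<^sub>2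
    = falling N (int (n + m\<^sub>1 + m\<^sub>2)) (m\<^sub>1 + m\<^sub>2)"
  using falling_eq_factorial [of n m\<^sub>1] falling_eq_factorial [of "n + m\<^sub>1" m\<^sub>2]
    falling_eq_factorial [of n "m\<^sub>1 + m\<^sub>2"] factorial_pos [of "n + m\<^sub>1"]
  by (simp add: add.assoc)

lemma mixed_moment_sums:
  assumes fam: "neg_trinomial_family N 1 Q" and \<alpha>\<^sub>2: "0 < \<alpha>\<^sub>2" "\<alpha>\<^sub>2 < 1"
  shows "(\<lambda>j. \<alpha>\<^sub>1 ^ m\<^sub>1 * falling N (int (n + j + m\<^sub>1)) m\<^sub>1
      * (falling inv_number (int j) m\<^sub>2 * negbin \<alpha>\<^sub>2 n j
        / oplus_power 1 Q (1 ^ (Suc n + j)) (\<alpha>\<^sub>2 * Q ^ (Suc n + j)) m\<^sub>1))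
    sums (\<alpha>\<^sub>1 ^ m\<^sub>1 * \<alpha>\<^sub>2 ^ m\<^sub>2 * falling N (int (n + m\<^sub>1 + m\<^sub>2)) (m\<^sub>1 + m\<^sub>2))"
proof -
  have "\<alpha>\<^sub>1 ^ m\<^sub>1 * falling N (int (n + j + m\<^sub>1)) m\<^sub>1
      * (falling inv_number (int j) m\<^sub>2 * negbin \<alpha>\<^sub>2 n j
        / oplus_power 1 Q (1 ^ (Suc n + j)) (\<alpha>\<^sub>2 * Q ^ (Suc n + j)) m\<^sub>1)
    = \<alpha>\<^sub>1 ^ m\<^sub>1 * falling N (int (n + m\<^sub>1)) m\<^sub>1
      * (falling inv_number (int j) m\<^sub>2 * negbin \<alpha>\<^sub>2 (n + m\<^sub>1) j)" (is "?l j = ?r j") for j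
  proof -
    have "?l j = \<alpha>\<^sub>1 ^ m\<^sub>1 * falling inv_number (int j) m\<^sub>2 * (falling N (int (n + j + m\<^sub>1)) m\<^sub>1
      * negbin \<alpha>\<^sub>2 n j / oplus_power 1 Q (1 ^ (Suc n + j)) (\<alpha>\<^sub>2 * Q ^ (Suc n + j)) m\<^sub>1)"
      by simp
    then show ?thesis unfolding falling_negbin_div_oplus_power [OF \<alpha>\<^sub>2(1)] by simp
  qed
  moreover have "?r sums (\<alpha>\<^sub>1 ^ m\<^sub>1 * falling N (int (n + m\<^sub>1)) m\<^sub>1
      * (\<alpha>\<^sub>2 ^ m\<^sub>2 * falling N (int (n + m\<^sub>1 + m\<^sub>2)) m\<^sub>2))"
    by (intro sums_mult falling_inv_number_sums assms)
  moreover have "\<alpha>\<^sub>1 ^ m\<^sub>1 * falling N (int (n + m\<^sub>1)) m\<^sub>1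
      * (\<alpha>\<^sub>2 ^ m\<^sub>2 * falling N (int (n + m\<^sub>1 + m\<^sub>2)) m\<^sub>2)
    = \<alpha>\<^sub>1 ^ m\<^sub>1 * \<alpha>\<^sub>2 ^ m\<^sub>2 * falling N (int (n + m\<^sub>1 + m\<^sub>2)) (m\<^sub>1 + m\<^sub>2)"
    by (simp only: falling_add [symmetric]) simp
  ultimately show ?thesis by (simp only:)
qed

end

section \<open>Expectations of functions of a pair of natural numbers\<close>

lemma nn_integral_nat_pair:
  fixes W\<^sub>1 W\<^sub>2 :: "'a \<Rightarrow> nat" and f :: "nat \<Rightarrow> nat \<Rightarrow> ennreal"
  assumes W [measurable]: "W\<^sub>1 \<in> measurable M (count_space UNIV)" "W\<^sub>2 \<in> measurable M (count_space UNIV)"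
  shows "(\<integral>\<^sup>+\<omega>. f (W\<^sub>1 \<omega>) (W\<^sub>2 \<omega>) \<partial>M)
    = (\<Sum>j. \<Sum>i. f i j * emeasure M {\<omega> \<in> space M. W\<^sub>1 \<omega> = i \<and> W\<^sub>2 \<omega> = j})"
proof -
  define W where "W = (\<lambda>\<omega>. (W\<^sub>1 \<omega>, W\<^sub>2 \<omega>))"
  define P where "P = (\<lambda>(i, j). emeasure M {\<omega> \<in> space M. W\<^sub>1 \<omega> = i \<and> W\<^sub>2 \<omega> = j})"
  have W_vimage: "W -` {x} \<inter> space M = {\<omega> \<in> space M. W\<^sub>1 \<omega> = fst x \<and> W\<^sub>2 \<omega> = snd x}" for x
    by (auto simp: W_def)
  have W_meas [measurable]: "W \<in> measurable M (count_space UNIV)"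
    unfolding measurable_count_space_eq2_countable W_vimage by auto
  have "distr M (count_space UNIV) W = density (count_space UNIV) P"
  proof (rule measure_eqI_countable [where A = UNIV])
    fix x :: "nat \<times> nat"
    show "emeasure (distr M (count_space UNIV) W) {x} = emeasure (density (count_space UNIV) P) {x}"
      by (simp add: emeasure_distr W_vimage emeasure_density P_def split_beta)
  qed auto
  then have "(\<integral>\<^sup>+\<omega>. f (W\<^sub>1 \<omega>) (W\<^sub>2 \<omega>) \<partial>M) = (\<integral>\<^sup>+x. (\<lambda>(i, j). f i j) x \<partial>density (count_space UNIV) P)"
    by (subst (asm) eq_commute) (simp add: nn_integral_distr W_def)
  also have "\<dots> = (\<integral>\<^sup>+x. P x * (\<lambda>(i, j). f i j) x \<partial>count_space UNIV)"
    by (simp add: nn_integral_density)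
  also have "\<dots> = (\<integral>\<^sup>+j. \<integral>\<^sup>+i. P (i, j) * f i j \<partial>count_space UNIV \<partial>count_space UNIV)"
    using nn_integral_snd_count_space [of "\<lambda>x. P x * (\<lambda>(i, j). f i j) x"] by simp
  also have "\<dots> = (\<Sum>j. \<Sum>i. f i j * emeasure M {\<omega> \<in> space M. W\<^sub>1 \<omega> = i \<and> W\<^sub>2 \<omega> = j})"
    by (simp add: nn_integral_count_space_nat P_def mult.commute)
  finally show ?thesis .
qed

text \<open>By Tonelli's theorem, a finite iterated sum of nonnegative terms proves integrability along
  with the value of the integral.\<close>

lemma has_bochner_integral_nat_pair:
  fixes W\<^sub>1 W\<^sub>2 :: "'a \<Rightarrow> nat" and f :: "nat \<Rightarrow> nat \<Rightarrow> real"
  assumes "finite_measure M"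
    and W [measurable]: "W\<^sub>1 \<in> measurable M (count_space UNIV)" "W\<^sub>2 \<in> measurable M (count_space UNIV)"
    and f: "\<And>i j. 0 \<le> f i j"
    and inner: "\<And>j. (\<lambda>i. f i j * measure M {\<omega> \<in> space M. W\<^sub>1 \<omega> = i \<and> W\<^sub>2 \<omega> = j}) sums g j"
    and outer: "g sums x"
  shows "has_bochner_integral M (\<lambda>\<omega>. f (W\<^sub>1 \<omega>) (W\<^sub>2 \<omega>)) x"
proof (rule has_bochner_integral_nn_integral)
  interpret finite_measure M by fact
  have nn: "0 \<le> f i j * measure M {\<omega> \<in> space M. W\<^sub>1 \<omega> = i \<and> W\<^sub>2 \<omega> = j}" for i j
    by (simp add: f)
  have g: "0 \<le> g j" for j by (rule sums_le [OF nn sums_zero inner])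
  show "0 \<le> x" by (rule sums_le [OF g sums_zero outer])
  have "(\<integral>\<^sup>+\<omega>. ennreal (f (W\<^sub>1 \<omega>) (W\<^sub>2 \<omega>)) \<partial>M)
      = (\<Sum>j. \<Sum>i. ennreal (f i j * measure M {\<omega> \<in> space M. W\<^sub>1 \<omega> = i \<and> W\<^sub>2 \<omega> = j}))"
    by (subst nn_integral_nat_pair [OF W, of "\<lambda>i j. ennreal (f i j)"])
      (simp add: emeasure_eq_measure ennreal_mult [symmetric] f)
  also have "\<dots> = (\<Sum>j. ennreal (g j))"
    by (simp add: suminf_ennreal_eq [OF nn inner])
  also have "\<dots> = ennreal x" by (rule suminf_ennreal_eq [OF g outer])
  finally show "(\<integral>\<^sup>+\<omega>. ennreal (f (W\<^sub>1 \<omega>) (W\<^sub>2 \<omega>)) \<partial>M) = ennreal x" .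
  have "(\<lambda>\<omega>. (\<lambda>j. (\<lambda>i. f i j) (W\<^sub>1 \<omega>)) (W\<^sub>2 \<omega>)) \<in> borel_measurable M"
    by (rule measurable_compose_countable [OF measurable_compose [OF W(1)] W(2)]) simp
  then show "(\<lambda>\<omega>. f (W\<^sub>1 \<omega>) (W\<^sub>2 \<omega>)) \<in> borel_measurable M" by simp
qed (simp add: f)

context q_numbers
begin

context
  fixes M :: "'a measure" and W\<^sub>1 W\<^sub>2 :: "'a \<Rightarrow> nat" and n :: nat and \<alpha>\<^sub>1 \<alpha>\<^sub>2 :: real
  assumes fam: "neg_trinomial_family N 1 Q"
    and \<alpha>\<^sub>1: "0 < \<alpha>\<^sub>1" "\<alpha>\<^sub>1 < 1" and \<alpha>\<^sub>2: "0 < \<alpha>\<^sub>2" "\<alpha>\<^sub>2 < 1"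
    and M: "prob_space M"
    and W: "W\<^sub>1 \<in> measurable M (count_space UNIV)" "W\<^sub>2 \<in> measurable M (count_space UNIV)"
    and mass: "\<And>i j. measure M {\<omega> \<in> space M. W\<^sub>1 \<omega> = i \<and> W\<^sub>2 \<omega> = j}
      = neg_trinomial_mass N 1 Q (Suc n) \<alpha>\<^sub>1 \<alpha>\<^sub>2 i j"
begin

lemma mixed_moment:
  "has_bochner_integral M
     (\<lambda>\<omega>. falling inv_number (int (W\<^sub>1 \<omega>)) m\<^sub>1 * falling inv_number (int (W\<^sub>2 \<omega>)) m\<^sub>2
       / oplus_power 1 Q (1 ^ (Suc n + W\<^sub>2 \<omega>)) (\<alpha>\<^sub>2 * Q ^ (Suc n + W\<^sub>2 \<omega>)) m\<^sub>1)
     (\<alpha>\<^sub>1 ^ m\<^sub>1 * \<alpha>\<^sub>2 ^ m\<^sub>2 * falling N (int (n + m\<^sub>1 + m\<^sub>2)) (m\<^sub>1 + m\<^sub>2))"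
proof (rule has_bochner_integral_nat_pair [where f = "\<lambda>i j. falling inv_number (int i) m\<^sub>1
    * falling inv_number (int j) m\<^sub>2 / oplus_power 1 Q (1 ^ (Suc n + j)) (\<alpha>\<^sub>2 * Q ^ (Suc n + j)) m\<^sub>1",
    OF _ W _ _ mixed_moment_sums [OF fam \<alpha>\<^sub>2]])
  show "finite_measure M" using M by (rule prob_space.finite_measure)
  show "0 \<le> falling inv_number (int i) m\<^sub>1 * falling inv_number (int j) m\<^sub>2
      / oplus_power 1 Q (1 ^ (Suc n + j)) (\<alpha>\<^sub>2 * Q ^ (Suc n + j)) m\<^sub>1" for i j
    using oplus_power_pos [of "\<alpha>\<^sub>2 * Q ^ (Suc n + j)" m\<^sub>1] \<alpha>\<^sub>2 Q_pos
    by (simp add: falling_inv_number_nonneg)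
  fix j
  define c where "c = falling inv_number (int j) m\<^sub>2 * negbin \<alpha>\<^sub>2 n j
    / oplus_power 1 Q (1 ^ (Suc n + j)) (\<alpha>\<^sub>2 * Q ^ (Suc n + j)) m\<^sub>1"
  have "(\<lambda>i. falling inv_number (int i) m\<^sub>1 * negbin \<alpha>\<^sub>1 (n + j) i * c)
      sums (\<alpha>\<^sub>1 ^ m\<^sub>1 * falling N (int (n + j + m\<^sub>1)) m\<^sub>1 * c)"
    by (intro sums_mult2 falling_inv_number_sums fam \<alpha>\<^sub>1)
  then show "(\<lambda>i. falling inv_number (int i) m\<^sub>1 * falling inv_number (int j) m\<^sub>2
      / oplus_power 1 Q (1 ^ (Suc n + j)) (\<alpha>\<^sub>2 * Q ^ (Suc n + j)) m\<^sub>1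
      * measure M {\<omega> \<in> space M. W\<^sub>1 \<omega> = i \<and> W\<^sub>2 \<omega> = j})
    sums (\<alpha>\<^sub>1 ^ m\<^sub>1 * falling N (int (n + j + m\<^sub>1)) m\<^sub>1 * (falling inv_number (int j) m\<^sub>2 * negbin \<alpha>\<^sub>2 n j
      / oplus_power 1 Q (1 ^ (Suc n + j)) (\<alpha>\<^sub>2 * Q ^ (Suc n + j)) m\<^sub>1))"
    by (simp only: mass neg_trinomial_mass_eq c_def) (simp add: mult_ac)
qed

lemma marginal_mass: "measure M {\<omega> \<in> space M. W\<^sub>2 \<omega> = w} = negbin \<alpha>\<^sub>2 n w"
proof -
  interpret prob_space M by (rule M)
  note [measurable] = W
  let ?A = "{\<omega> \<in> space M. W\<^sub>2 \<omega> = w}"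
  have "has_bochner_integral M (\<lambda>\<omega>. if W\<^sub>2 \<omega> = w then 1 else 0 :: real) (negbin \<alpha>\<^sub>2 n w)"
  proof (rule has_bochner_integral_nat_pair [where f = "\<lambda>i j. if j = w then 1 else 0", OF _ W])
    show "(\<lambda>i. (if j = w then 1 else 0) * measure M {\<omega> \<in> space M. W\<^sub>1 \<omega> = i \<and> W\<^sub>2 \<omega> = j})
      sums (if j = w then negbin \<alpha>\<^sub>2 n w else 0)" for j
      using sums_mult2 [OF negbin_sums_1 [OF fam \<alpha>\<^sub>1, of "n + w"], of "negbin \<alpha>\<^sub>2 n w"]
      by (simp add: mass neg_trinomial_mass_eq)
    show "(\<lambda>j. if j = w then negbin \<alpha>\<^sub>2 n w else 0) sums negbin \<alpha>\<^sub>2 n w"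
      using sums_single [of w "\<lambda>_. negbin \<alpha>\<^sub>2 n w"] by simp
  qed (auto intro: finite_measure_axioms)
  moreover have "has_bochner_integral M (indicator ?A :: 'a \<Rightarrow> real) (measure M ?A)"
    by (rule has_bochner_integral_real_indicator) (auto simp: less_top [symmetric])
  moreover have "has_bochner_integral M (indicator ?A :: 'a \<Rightarrow> real) (measure M ?A)
      = has_bochner_integral M (\<lambda>\<omega>. if W\<^sub>2 \<omega> = w then 1 else 0 :: real) (measure M ?A)"
    by (rule has_bochner_integral_cong) (auto simp: indicator_def)
  ultimately show ?thesis by (simp only:) (rule has_bochner_integral_eq)
qed

lemma conditional_moment:
  "has_bochner_integral (uniform_measure M {\<omega> \<in> space M. W\<^sub>2 \<omega> = w})
     (\<lambda>\<omega>. falling inv_number (int (W\<^sub>1 \<omega>)) m)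
     (\<alpha>\<^sub>1 ^ m * falling N (int (n + w + m)) m)"
proof -
  interpret prob_space M by (rule M)
  note [measurable] = W
  let ?A = "{\<omega> \<in> space M. W\<^sub>2 \<omega> = w}"
  let ?U = "uniform_measure M ?A"
  let ?x = "\<alpha>\<^sub>1 ^ m * falling N (int (n + w + m)) m"
  have pos: "0 < negbin \<alpha>\<^sub>2 n w" by (rule negbin_pos) (rule \<alpha>\<^sub>2)
  then have A: "emeasure M ?A \<noteq> 0" "emeasure M ?A \<noteq> \<infinity>"
    by (simp_all add: emeasure_eq_measure marginal_mass)
  have cond: "measure ?U {\<omega> \<in> space ?U. W\<^sub>1 \<omega> = i \<and> W\<^sub>2 \<omega> = j}
      = (if j = w then negbin \<alpha>\<^sub>1 (n + w) i else 0)" for i j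
  proof -
    have "measure ?U {\<omega> \<in> space ?U. W\<^sub>1 \<omega> = i \<and> W\<^sub>2 \<omega> = j}
        = measure M (?A \<inter> {\<omega> \<in> space M. W\<^sub>1 \<omega> = i \<and> W\<^sub>2 \<omega> = j}) / negbin \<alpha>\<^sub>2 n w"
      by (simp only: space_uniform_measure) (subst measure_uniform_measure [OF A], simp_all add: marginal_mass)
    also have "?A \<inter> {\<omega> \<in> space M. W\<^sub>1 \<omega> = i \<and> W\<^sub>2 \<omega> = j}
        = (if j = w then {\<omega> \<in> space M. W\<^sub>1 \<omega> = i \<and> W\<^sub>2 \<omega> = w} else {})"
      by auto
    finally show ?thesis using pos by (simp add: mass neg_trinomial_mass_eq split: if_splits)
  qed
  have W_U: "W\<^sub>1 \<in> measurable ?U (count_space UNIV)" "W\<^sub>2 \<in> measurable ?U (count_space UNIV)"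
    using W by simp_all
  show ?thesis
  proof (rule has_bochner_integral_nat_pair [where f = "\<lambda>i j. falling inv_number (int i) m"
        and g = "\<lambda>j. if j = w then ?x else 0", OF _ W_U])
    show "finite_measure ?U" by (rule prob_space.finite_measure [OF prob_space_uniform_measure [OF A]])
    show "(\<lambda>i. falling inv_number (int i) m * measure ?U {\<omega> \<in> space ?U. W\<^sub>1 \<omega> = i \<and> W\<^sub>2 \<omega> = j})
        sums (if j = w then ?x else 0)" for j
      unfolding cond using falling_inv_number_sums [OF fam \<alpha>\<^sub>1, of m "n + w"] by simp
    show "(\<lambda>j. if j = w then ?x else 0) sums ?x"
      using sums_single [of w "\<lambda>_. ?x"] by simp
  qed (rule falling_inv_number_nonneg)
qed

end

end

theorem theorem2p6:
  fixes p q \<phi>\<^sub>1 \<phi>\<^sub>2 \<alpha>\<^sub>1 \<alpha>\<^sub>2 :: real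
    and R :: "complex \<Rightarrow> complex \<Rightarrow> complex"
    and r :: "int \<Rightarrow> int \<Rightarrow> complex"
    and l n m\<^sub>1 m\<^sub>2 :: nat
    and M :: "'a measure"
    and W\<^sub>1 W\<^sub>2 :: "'a \<Rightarrow> nat"
  assumes "Rpq_deformation p q R r l \<phi>\<^sub>1 \<phi>\<^sub>2"
    and "neg_trinomial_family (Rnum R p q) \<phi>\<^sub>1 \<phi>\<^sub>2"
    and "1 \<le> n"
    and "0 < \<alpha>\<^sub>1" "\<alpha>\<^sub>1 < 1" "0 < \<alpha>\<^sub>2" "\<alpha>\<^sub>2 < 1"
    and "prob_space M"
    and "W\<^sub>1 \<in> measurable M (count_space UNIV)"
    and "W\<^sub>2 \<in> measurable M (count_space UNIV)"
    and "\<And>w\<^sub>1 w\<^sub>2. measure M {\<omega> \<in> space M. W\<^sub>1 \<omega> = w\<^sub>1 \<and> W\<^sub>2 \<omega> = w\<^sub>2}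
           = neg_trinomial_mass (Rnum R p q) \<phi>\<^sub>1 \<phi>\<^sub>2 n \<alpha>\<^sub>1 \<alpha>\<^sub>2 w\<^sub>1 w\<^sub>2"
  shows "has_bochner_integral M
           (\<lambda>\<omega>. falling (Rnum_inv R p q \<phi>\<^sub>1 \<phi>\<^sub>2) (int (W\<^sub>2 \<omega>)) m\<^sub>2)
           (\<alpha>\<^sub>2 ^ m\<^sub>2 * falling (Rnum R p q) (int n + int m\<^sub>2 - 1) m\<^sub>2)
    \<and> (\<forall>w\<^sub>2. has_bochner_integral (uniform_measure M {\<omega> \<in> space M. W\<^sub>2 \<omega> = w\<^sub>2})
           (\<lambda>\<omega>. falling (Rnum_inv R p q \<phi>\<^sub>1 \<phi>\<^sub>2) (int (W\<^sub>1 \<omega>)) m\<^sub>1)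
           (\<alpha>\<^sub>1 ^ m\<^sub>1 * falling (Rnum R p q) (int n + int w\<^sub>2 + int m\<^sub>1 - 1) m\<^sub>1))
    \<and> has_bochner_integral M
           (\<lambda>\<omega>. falling (Rnum_inv R p q \<phi>\<^sub>1 \<phi>\<^sub>2) (int (W\<^sub>1 \<omega>)) m\<^sub>1
             / oplus_power \<phi>\<^sub>1 \<phi>\<^sub>2 (\<phi>\<^sub>1 ^ (n + W\<^sub>2 \<omega>)) (\<alpha>\<^sub>2 * \<phi>\<^sub>2 ^ (n + W\<^sub>2 \<omega>)) m\<^sub>1)
           (\<alpha>\<^sub>1 ^ m\<^sub>1 * falling (Rnum R p q) (int n + int m\<^sub>1 - 1) m\<^sub>1)
    \<and> has_bochner_integral M
           (\<lambda>\<omega>. falling (Rnum_inv R p q \<phi>\<^sub>1 \<phi>\<^sub>2) (int (W\<^sub>1 \<omega>)) m\<^sub>1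
               * falling (Rnum_inv R p q \<phi>\<^sub>1 \<phi>\<^sub>2) (int (W\<^sub>2 \<omega>)) m\<^sub>2
             / oplus_power \<phi>\<^sub>1 \<phi>\<^sub>2 (\<phi>\<^sub>1 ^ (n + W\<^sub>2 \<omega>)) (\<alpha>\<^sub>2 * \<phi>\<^sub>2 ^ (n + W\<^sub>2 \<omega>)) m\<^sub>1)
           (\<alpha>\<^sub>1 ^ m\<^sub>1 * \<alpha>\<^sub>2 ^ m\<^sub>2
             * falling (Rnum R p q) (int n + int m\<^sub>1 + int m\<^sub>2 - 1) (m\<^sub>1 + m\<^sub>2))"
proof -
  interpret Rpq_deformation p q R r l \<phi>\<^sub>1 \<phi>\<^sub>2 by fact
  have number: "Rnum R p q (int k) = (\<phi>\<^sub>1 ^ k - \<phi>\<^sub>2 ^ k) / (\<phi>\<^sub>1 - \<phi>\<^sub>2)" for k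
    unfolding Rnum_def power_int_of_nat R_phi by (rule Re_complex_of_real)
  interpret pair: deformed_numbers "Rnum R p q" \<phi>\<^sub>1 \<phi>\<^sub>2
    by unfold_locales (use phi_distinct number R_pos in \<open>auto simp: Rnum_def\<close>)
  have one: "\<phi>\<^sub>1 = 1" using assms(2) phi_nonzero by (rule pair.family_imp_a_eq_1)
  have "0 < \<phi>\<^sub>2" using assms(2) phi_nonzero by (rule pair.family_signs)
  interpret q_numbers "Rnum R p q" \<phi>\<^sub>2
    by unfold_locales (use phi_distinct number one R_pos \<open>0 < \<phi>\<^sub>2\<close> in \<open>auto simp: Rnum_def\<close>)
  obtain n' where n: "n = Suc n'" using \<open>1 \<le> n\<close> by (cases n) auto
  have inv: "Rnum_inv R p q 1 \<phi>\<^sub>2 = inv_number"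
    by (simp add: fun_eq_iff Rnum_inv_def inv_number_def)
  note hyps = assms(2) [unfolded one] assms(4-10) assms(11) [unfolded one n]
  note mixed = mixed_moment [OF hyps]
  show ?thesis
    using mixed [of 0 m\<^sub>2] mixed [of m\<^sub>1 0] mixed [of m\<^sub>1 m\<^sub>2] conditional_moment [OF hyps]
    unfolding one inv n by (simp add: add_ac)
qed

end
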